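(* Let $0<\beta_B<1$ and let $K\ge1$ be an integer. Let $(X_t)_{t\in\mathbb{Z}}$ be a centered random real matrix-valued process of fixed size, and consider the recursions $$Z_t=\beta_BZ_{t-1}+(1-\beta_B)X_t,\qquad Y_j=\beta_B^KY_{j-1}+(1-\beta_B^K)X_{jK}.$$ (i) If $\operatorname{vec}(X_t)$ is weakly stationary with finite covariance and both recursions are in steady state, then at refresh boundaries (times $jK$) $$\operatorname{Cov}(\operatorname{vec}Y_j)\succeq\operatorname{Cov}(\operatorname{vec}Z_{jK}).$$ (ii) If the observations $X_t$ are temporally i.i.d. with $\operatorname{Cov}(\operatorname{vec}X_t)=\Sigma$, and both recursions are in steady state, then $$\operatorname{Cov}(\operatorname{vec}Y)=\frac{1-\beta_B^K}{1+\beta_B^K}\,\Sigma,\qquad \operatorname{Cov}(\operatorname{vec}Z)=\frac{1-\beta_B}{1+\beta_B}\,\Sigma .$$ (iii) For an affine signal observed without noise (that is, when $X_t$ is replaced by the deterministic signal $x_t=a+vt$), the phase-averaged lag of the held estimator is $$L_K=\frac{K\beta_B^K}{1-\beta_B^K}+\frac{K-1}{2}.$$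
   Context: $\succeq$ is the Loewner (positive semidefinite) order. "Steady state" means the stationary solutions of the recursions driven by the infinite past: $Z_t=(1-\beta_B)\sum_{i\ge0}\beta_B^iX_{t-i}$ and $Y_j=(1-\beta_B^K)\sum_{i\ge0}\beta_B^{Ki}X_{(j-i)K}$ (convergence in mean square; for the deterministic affine signal, ordinary convergence). The held estimator takes the value $Y_j$ at all times $jK+s$ with phase $s\in\{0,\dots,K-1\}$. For the affine signal $x_t=a+vt$ with $v\neq0$, its lag at phase $s$ is the number $\ell_s$ with $x_{jK+s}-Y_j=v\,\ell_s$, i.e. $Y_j=x_{jK+s-\ell_s}$ (extending $x_t=a+vt$ to real $t$), and the phase-averaged lag is $L_K=\frac1K\sum_{s=0}^{K-1}\ell_s$. *)

theory Defs
  imports "HOL-Probability.Probability"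
begin

(* The index (j, i) refers to column j and row i, so that the lexicographic order of the
   index pairs is the usual column stacking.  The library constant vec is unrelated
   (it builds constant vectors). *)
definition vectorize :: "real^'n^'m \<Rightarrow> real^('n \<times> 'm)" where
  "vectorize A = (\<chi> p. A $ snd p $ fst p)"

definition psd :: "real^'d^'d \<Rightarrow> bool" where
  "psd A \<longleftrightarrow> transpose A = A \<and> (\<forall>x. 0 \<le> x \<bullet> (A *v x))"

definition loewner_ge :: "real^'d^'d \<Rightarrow> real^'d^'d \<Rightarrow> bool" (infix "\<succeq>" 50) where
  "A \<succeq> B \<longleftrightarrow> psd (A - B)"

definition square_integrable :: "'w measure \<Rightarrow> ('w \<Rightarrow> 'b::euclidean_space) \<Rightarrow> bool" where
  "square_integrable M V \<longleftrightarrow>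
     V \<in> borel_measurable M \<and> integrable M (\<lambda>\<omega>. (norm (V \<omega>))\<^sup>2)"

(* Only meaningful for square-integrable U and V: Bochner integrals of non-integrable
   functions are 0. *)
definition cross_cov :: "'w measure \<Rightarrow> ('w \<Rightarrow> real^'d) \<Rightarrow> ('w \<Rightarrow> real^'d) \<Rightarrow> real^'d^'d" where
  "cross_cov M U V =
     (\<chi> i j. \<integral>\<omega>. (U \<omega> $ i - (\<integral>\<omega>'. U \<omega>' $ i \<partial>M)) * (V \<omega> $ j - (\<integral>\<omega>'. V \<omega>' $ j \<partial>M)) \<partial>M)"

definition Cov :: "'w measure \<Rightarrow> ('w \<Rightarrow> real^'d) \<Rightarrow> real^'d^'d" where
  "Cov M V = cross_cov M V V"

definition centered_process :: "'w measure \<Rightarrow> (int \<Rightarrow> 'w \<Rightarrow> 'b::euclidean_space) \<Rightarrow> bool" where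
  "centered_process M X \<longleftrightarrow> (\<forall>t. integrable M (X t) \<and> (\<integral>\<omega>. X t \<omega> \<partial>M) = 0)"

definition weakly_stationary :: "'w measure \<Rightarrow> (int \<Rightarrow> 'w \<Rightarrow> real^'d) \<Rightarrow> bool" where
  "weakly_stationary M V \<longleftrightarrow>
     (\<forall>t. square_integrable M (V t)) \<and>
     (\<forall>s t. (\<integral>\<omega>. V s \<omega> \<partial>M) = (\<integral>\<omega>. V t \<omega> \<partial>M)) \<and>
     (\<forall>s t h. cross_cov M (V (s + h)) (V (t + h)) = cross_cov M (V s) (V t))"

definition iid_process :: "'w measure \<Rightarrow> (int \<Rightarrow> 'w \<Rightarrow> 'b::euclidean_space) \<Rightarrow> bool" where
  "iid_process M X \<longleftrightarrow>
     prob_space.indep_vars M (\<lambda>_. borel) X UNIV \<and>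
     (\<forall>s t. distr M borel (X s) = distr M borel (X t))"

definition mean_square_sums ::
    "'w measure \<Rightarrow> (nat \<Rightarrow> 'w \<Rightarrow> 'b::euclidean_space) \<Rightarrow> ('w \<Rightarrow> 'b) \<Rightarrow> bool" where
  "mean_square_sums M f S \<longleftrightarrow>
     (\<forall>i. square_integrable M (f i)) \<and> square_integrable M S \<and>
     (\<lambda>n. \<integral>\<omega>. (norm ((\<Sum>i<n. f i \<omega>) - S \<omega>))\<^sup>2 \<partial>M) \<longlonglongrightarrow> 0"

(* Steady state of W t = \<gamma> W (t - 1) + (1 - \<gamma>) U t.  The fast recursion has \<gamma> = \<beta> and U = X;
   the held one has \<gamma> = \<beta> ^ K and the subsampled input U j = X (j K).
   For 0 < \<gamma> < 1 the first conjunct follows from the second. *)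
definition steady_state ::
    "'w measure \<Rightarrow> real \<Rightarrow> (int \<Rightarrow> 'w \<Rightarrow> 'b::euclidean_space) \<Rightarrow> (int \<Rightarrow> 'w \<Rightarrow> 'b) \<Rightarrow> bool" where
  "steady_state M \<gamma> U W \<longleftrightarrow>
     (\<forall>t. AE \<omega> in M. W t \<omega> = \<gamma> *\<^sub>R W (t - 1) \<omega> + (1 - \<gamma>) *\<^sub>R U t \<omega>) \<and>
     (\<forall>t. mean_square_sums M (\<lambda>i \<omega>. ((1 - \<gamma>) * \<gamma> ^ i) *\<^sub>R U (t - int i) \<omega>) (W t))"

(* The same for a deterministic input, with ordinary convergence. *)
definition det_steady_state ::
    "real \<Rightarrow> (int \<Rightarrow> 'b::euclidean_space) \<Rightarrow> (int \<Rightarrow> 'b) \<Rightarrow> bool" where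
  "det_steady_state \<gamma> u w \<longleftrightarrow>
     (\<forall>t. w t = \<gamma> *\<^sub>R w (t - 1) + (1 - \<gamma>) *\<^sub>R u t) \<and>
     (\<forall>t. (\<lambda>i. ((1 - \<gamma>) * \<gamma> ^ i) *\<^sub>R u (t - int i)) sums w t)"

definition affine_signal :: "'b::real_vector \<Rightarrow> 'b \<Rightarrow> real \<Rightarrow> 'b" where
  "affine_signal a v t = a + t *\<^sub>R v"

(* Integer division rounds down, so this is Y j at all times j K + s with 0 \<le> s < K. *)
definition held :: "nat \<Rightarrow> (int \<Rightarrow> 'b) \<Rightarrow> int \<Rightarrow> 'b" where
  "held K Y t = Y (t div int K)"

definition is_lag ::
    "nat \<Rightarrow> 'b::real_vector \<Rightarrow> 'b \<Rightarrow> (int \<Rightarrow> 'b) \<Rightarrow> int \<Rightarrow> nat \<Rightarrow> real \<Rightarrow> bool" where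
  "is_lag K a v Y j s l \<longleftrightarrow>
     (let t = j * int K + int s in affine_signal a v (of_int t) - held K Y t = l *\<^sub>R v)"

definition lag :: "nat \<Rightarrow> 'b::real_vector \<Rightarrow> 'b \<Rightarrow> (int \<Rightarrow> 'b) \<Rightarrow> int \<Rightarrow> nat \<Rightarrow> real" where
  "lag K a v Y j s = (THE l. is_lag K a v Y j s l)"

definition phase_averaged_lag ::
    "nat \<Rightarrow> 'b::real_vector \<Rightarrow> 'b \<Rightarrow> (int \<Rightarrow> 'b) \<Rightarrow> int \<Rightarrow> real" where
  "phase_averaged_lag K a v Y j = (1 / real K) * (\<Sum>s<K. lag K a v Y j s)"

end

theory Submission
  imports Defs
begin

text \<open>For (i), an index \<open>i\<close> of the fast recursion is written as \<open>k + l K\<close> with \<open>k < K\<close>.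
  This exhibits \<open>Z\<close> as a convex combination, with weights proportional to \<open>\<beta>\<^sup>k\<close>, of \<open>K\<close> time-shifted
  copies of \<open>Y\<close>.  Stationarity gives all copies the same second moment in each direction, and
  Jensen's inequality for the square gives the Loewner inequality.  Working with quadratic forms of
  the finite partial sums avoids constructing the shifted copies as mean-square limits.
  For (ii), independence leaves only the diagonal terms of the square, which form a
  geometric series.  For (iii), \<open>Y\<^sub>j\<close> is the signal delayed by the mean delay
  \<open>K \<beta>\<^sup>K / (1 - \<beta>\<^sup>K)\<close> of the geometric weights, and holding adds the phase \<open>s\<close>.\<close>

section \<open>Square-integrable functions and the Cauchy-Schwarz inequality\<close>

lemma square_integrable_add:
  assumes "square_integrable M f" "square_integrable M g"
  shows "square_integrable M (\<lambda>\<omega>. f \<omega> + g \<omega>)"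
proof -
  have [measurable]: "f \<in> borel_measurable M" "g \<in> borel_measurable M"
    using assms by (auto simp: square_integrable_def)
  have "integrable M (\<lambda>\<omega>. (norm (f \<omega> + g \<omega>))\<^sup>2)"
  proof (rule Bochner_Integration.integrable_bound)
    show "integrable M (\<lambda>\<omega>. 2 * (norm (f \<omega>))\<^sup>2 + 2 * (norm (g \<omega>))\<^sup>2)"
      using assms by (auto simp: square_integrable_def)
    have "(norm (f \<omega> + g \<omega>))\<^sup>2 \<le> 2 * (norm (f \<omega>))\<^sup>2 + 2 * (norm (g \<omega>))\<^sup>2" for \<omega>
    proof -
      have "(norm (f \<omega> + g \<omega>))\<^sup>2 \<le> (norm (f \<omega>) + norm (g \<omega>))\<^sup>2"
        by (simp add: norm_triangle_ineq power_mono)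
      also have "\<dots> \<le> 2 * (norm (f \<omega>))\<^sup>2 + 2 * (norm (g \<omega>))\<^sup>2"
        using sum_squares_bound[of "norm (f \<omega>)" "norm (g \<omega>)"] by (simp add: power2_sum)
      finally show ?thesis .
    qed
    then show "AE \<omega> in M. norm ((norm (f \<omega> + g \<omega>))\<^sup>2)
        \<le> norm (2 * (norm (f \<omega>))\<^sup>2 + 2 * (norm (g \<omega>))\<^sup>2)"
      by (simp add: add_nonneg_nonneg)
  qed measurable
  then show ?thesis by (simp add: square_integrable_def)
qed

text \<open>The norm grows by at most a constant factor, whose square dominates the integrand. One
  rule thus serves coordinates, scalar multiples, \<open>vectorize\<close> and inner products with a
  fixed vector.\<close>

lemma square_integrable_bounded_linear:
  assumes "bounded_linear \<phi>" and "square_integrable M f"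
  shows "square_integrable M (\<lambda>\<omega>. \<phi> (f \<omega>))"
proof -
  obtain B where B: "\<And>x. norm (\<phi> x) \<le> norm x * B"
    using bounded_linear.bounded[OF assms(1)] by blast
  have [measurable]: "f \<in> borel_measurable M" using assms by (simp add: square_integrable_def)
  have [measurable]: "\<phi> \<in> borel_measurable borel"
    using assms(1) by (simp add: borel_measurable_continuous_onI linear_continuous_on)
  have "integrable M (\<lambda>\<omega>. (norm (\<phi> (f \<omega>)))\<^sup>2)"
  proof (rule Bochner_Integration.integrable_bound)
    show "integrable M (\<lambda>\<omega>. B\<^sup>2 * (norm (f \<omega>))\<^sup>2)"
      using assms by (auto simp: square_integrable_def)
    have "(norm (\<phi> (f \<omega>)))\<^sup>2 \<le> B\<^sup>2 * (norm (f \<omega>))\<^sup>2" for \<omega>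
      using power_mono[OF B, of "f \<omega>" 2] by (simp add: power_mult_distrib mult.commute)
    then show "AE \<omega> in M. norm ((norm (\<phi> (f \<omega>)))\<^sup>2) \<le> norm (B\<^sup>2 * (norm (f \<omega>))\<^sup>2)"
      by simp
  qed measurable
  then show ?thesis by (simp add: square_integrable_def)
qed

lemma square_integrable_diff:
  assumes "square_integrable M f" "square_integrable M g"
  shows "square_integrable M (\<lambda>\<omega>. f \<omega> - g \<omega>)"
  using square_integrable_add[OF assms(1)
      square_integrable_bounded_linear[OF bounded_linear_minus[OF bounded_linear_ident] assms(2)]]
  by simp

lemma square_integrable_sum:
  assumes "\<And>i. i \<in> I \<Longrightarrow> square_integrable M (f i)"
  shows "square_integrable M (\<lambda>\<omega>. \<Sum>i\<in>I. f i \<omega>)"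
  using assms
proof (induction I rule: infinite_finite_induct)
  case (insert i I)
  then show ?case by (simp add: square_integrable_add)
qed (auto simp: square_integrable_def)

lemma (in prob_space) square_integrable_const: "square_integrable M (\<lambda>_. c)"
  by (simp add: square_integrable_def)

text \<open>Polarization: the product is half the difference between the square of the sum and the
  two squares.\<close>

lemma integrable_mult_square_integrable:
  fixes f g :: "'w \<Rightarrow> real"
  assumes "square_integrable M f" "square_integrable M g"
  shows "integrable M (\<lambda>\<omega>. f \<omega> * g \<omega>)"
proof -
  have "integrable M (\<lambda>\<omega>. ((f \<omega> + g \<omega>)\<^sup>2 - (f \<omega>)\<^sup>2 - (g \<omega>)\<^sup>2) / 2)"
    using assms square_integrable_add[OF assms] by (auto simp: square_integrable_def)
  then show ?thesis by (simp add: power2_sum)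
qed

lemma (in prob_space) square_integrable_imp_integrable_real:
  fixes f :: "'a \<Rightarrow> real"
  assumes "square_integrable M f"
  shows "integrable M f"
  using integrable_mult_square_integrable[OF assms square_integrable_const[of 1]] by simp

text \<open>The second moment of \<open>s * f + t * g\<close> is a nonnegative quadratic form in
  \<open>s\<close> and \<open>t\<close>; suitable values of \<open>s\<close> and \<open>t\<close>
  give the discriminant bound.\<close>

lemma integral_Cauchy_Schwarz:
  fixes f g :: "'w \<Rightarrow> real"
  assumes f: "square_integrable M f" and g: "square_integrable M g"
  shows "(\<integral>\<omega>. f \<omega> * g \<omega> \<partial>M)\<^sup>2 \<le> (\<integral>\<omega>. (f \<omega>)\<^sup>2 \<partial>M) * (\<integral>\<omega>. (g \<omega>)\<^sup>2 \<partial>M)"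
proof -
  define a b c where "a = (\<integral>\<omega>. (f \<omega>)\<^sup>2 \<partial>M)" and "b = (\<integral>\<omega>. (g \<omega>)\<^sup>2 \<partial>M)"
    and "c = (\<integral>\<omega>. f \<omega> * g \<omega> \<partial>M)"
  have int: "integrable M (\<lambda>\<omega>. (f \<omega>)\<^sup>2)" "integrable M (\<lambda>\<omega>. (g \<omega>)\<^sup>2)"
      "integrable M (\<lambda>\<omega>. f \<omega> * g \<omega>)"
    using f g integrable_mult_square_integrable by (auto simp: square_integrable_def)
  have nonneg: "0 \<le> s\<^sup>2 * a + 2 * s * t * c + t\<^sup>2 * b" for s t
  proof -
    have "0 \<le> (\<integral>\<omega>. (s * f \<omega> + t * g \<omega>)\<^sup>2 \<partial>M)" by simp
    also have "\<dots> = (\<integral>\<omega>. s\<^sup>2 * (f \<omega>)\<^sup>2 + 2 * s * t * (f \<omega> * g \<omega>) + t\<^sup>2 * (g \<omega>)\<^sup>2 \<partial>M)"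
      by (simp add: power2_eq_square algebra_simps)
    also have "\<dots> = s\<^sup>2 * a + 2 * s * t * c + t\<^sup>2 * b"
      using int by (simp add: a_def b_def c_def)
    finally show ?thesis .
  qed
  have "c\<^sup>2 \<le> a * b"
  proof (cases "b = 0")
    case True
    have "c = 0"
    proof (rule ccontr)
      assume "c \<noteq> 0"
      \<comment> \<open>If \<open>b = 0\<close>, the form at \<open>s = 1\<close> is affine in
        \<open>t\<close> with slope \<open>2 * c\<close>. The chosen \<open>t\<close> makes it equal
        to -1.\<close>
      then show False
        using nonneg[of 1 "- (a + 1) / (2 * c)"] True by (simp add: field_simps)
    qed
    then show ?thesis using True by simp
  next
    case False
    have "b \<ge> 0" by (simp add: b_def)
    with False have "b > 0" by simp
    \<comment> \<open>At \<open>s = b\<close>, \<open>t = - c\<close> the form collapses to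
      \<open>b\<close> times the discriminant expression.\<close>
    moreover have "0 \<le> b * (a * b - c\<^sup>2)"
      using nonneg[of b "- c"] by (simp add: power2_eq_square algebra_simps)
    ultimately show ?thesis by (simp add: zero_le_mult_iff)
  qed
  then show ?thesis by (simp add: a_def b_def c_def)
qed

section \<open>Series that converge in mean square\<close>

text \<open>By linearity the new error is the image of the old one, so its second moment grows by at
  most \<open>B\<close> squared. This reduces matrix-valued series to scalar ones.\<close>

lemma mean_square_sums_bounded_linear:
  assumes "bounded_linear \<phi>" and "mean_square_sums M f S"
  shows "mean_square_sums M (\<lambda>i \<omega>. \<phi> (f i \<omega>)) (\<lambda>\<omega>. \<phi> (S \<omega>))"
proof -
  interpret \<phi>: bounded_linear \<phi> by fact
  obtain B where B: "\<And>x. norm (\<phi> x) \<le> norm x * B" using \<phi>.bounded by blast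
  have si: "square_integrable M (f i)" "square_integrable M S" for i
    using assms(2) by (auto simp: mean_square_sums_def)
  define D where "D n \<omega> = (\<Sum>i<n. f i \<omega>) - S \<omega>" for n \<omega>
  have D: "square_integrable M (D n)" for n
    unfolding D_def by (intro square_integrable_diff square_integrable_sum si)
  have "(\<lambda>n. \<integral>\<omega>. (norm (D n \<omega>))\<^sup>2 \<partial>M) \<longlonglongrightarrow> 0"
    using assms(2) by (simp add: mean_square_sums_def D_def)
  then have lim: "(\<lambda>n. B\<^sup>2 * (\<integral>\<omega>. (norm (D n \<omega>))\<^sup>2 \<partial>M)) \<longlonglongrightarrow> 0"
    using tendsto_mult_right_zero by blast
  have le: "(\<integral>\<omega>. (norm (\<phi> (D n \<omega>)))\<^sup>2 \<partial>M) \<le> B\<^sup>2 * (\<integral>\<omega>. (norm (D n \<omega>))\<^sup>2 \<partial>M)" for n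
  proof -
    have "(\<integral>\<omega>. (norm (\<phi> (D n \<omega>)))\<^sup>2 \<partial>M) \<le> (\<integral>\<omega>. B\<^sup>2 * (norm (D n \<omega>))\<^sup>2 \<partial>M)"
    proof (rule integral_mono)
      show "integrable M (\<lambda>\<omega>. (norm (\<phi> (D n \<omega>)))\<^sup>2)"
        using square_integrable_bounded_linear[OF assms(1) D] by (simp add: square_integrable_def)
      show "integrable M (\<lambda>\<omega>. B\<^sup>2 * (norm (D n \<omega>))\<^sup>2)"
        using D by (auto simp: square_integrable_def)
      show "(norm (\<phi> (D n \<omega>)))\<^sup>2 \<le> B\<^sup>2 * (norm (D n \<omega>))\<^sup>2" for \<omega>
        using power_mono[OF B, of "D n \<omega>" 2] by (simp add: power_mult_distrib mult.commute)
    qed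
    then show ?thesis by simp
  qed
  have "(\<lambda>n. \<integral>\<omega>. (norm (\<phi> (D n \<omega>)))\<^sup>2 \<partial>M) \<longlonglongrightarrow> 0"
    by (rule tendsto_sandwich[OF _ _ tendsto_const lim]) (use le in auto)
  moreover have "\<phi> (D n \<omega>) = (\<Sum>i<n. \<phi> (f i \<omega>)) - \<phi> (S \<omega>)" for n \<omega>
    by (simp add: D_def \<phi>.diff \<phi>.sum)
  ultimately show ?thesis
    using si by (simp add: mean_square_sums_def square_integrable_bounded_linear[OF assms(1)])
qed

text \<open>Mean-square convergence implies weak convergence: Cauchy-Schwarz bounds the square of
  the integral by the mean-square error times the second moment of \<open>g\<close>.\<close>

lemma mean_square_sums_inner_tendsto:
  fixes S :: "'w \<Rightarrow> real"
  assumes "mean_square_sums M f S" and g: "square_integrable M g"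
  shows "(\<lambda>n. \<integral>\<omega>. ((\<Sum>i<n. f i \<omega>) - S \<omega>) * g \<omega> \<partial>M) \<longlonglongrightarrow> 0"
proof -
  have si: "square_integrable M (\<lambda>\<omega>. (\<Sum>i<n. f i \<omega>) - S \<omega>)" for n
    using assms(1)
    by (intro square_integrable_diff square_integrable_sum) (auto simp: mean_square_sums_def)
  have "(\<lambda>n. (\<integral>\<omega>. ((\<Sum>i<n. f i \<omega>) - S \<omega>)\<^sup>2 \<partial>M) * (\<integral>\<omega>. (g \<omega>)\<^sup>2 \<partial>M)) \<longlonglongrightarrow> 0"
    using assms(1) by (intro tendsto_mult_left_zero) (simp add: mean_square_sums_def)
  then have "(\<lambda>n. (\<integral>\<omega>. ((\<Sum>i<n. f i \<omega>) - S \<omega>) * g \<omega> \<partial>M)\<^sup>2) \<longlonglongrightarrow> 0"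
    by (rule tendsto_sandwich[OF _ _ tendsto_const, rotated 2])
      (use integral_Cauchy_Schwarz[OF si g] in auto)
  then show ?thesis by simp
qed

lemma (in prob_space) mean_square_sums_expectation_tendsto:
  fixes S :: "'a \<Rightarrow> real"
  assumes "mean_square_sums M f S"
  shows "(\<lambda>n. \<Sum>i<n. expectation (f i)) \<longlonglongrightarrow> expectation S"
proof -
  have int: "integrable M (f i)" "integrable M S" for i
    using assms square_integrable_imp_integrable_real by (auto simp: mean_square_sums_def)
  have "(\<lambda>n. (\<Sum>i<n. expectation (f i)) - expectation S) \<longlonglongrightarrow> 0"
    \<comment> \<open>Testing against the constant 1 turns weak convergence into convergence of
      expectations.\<close>
    using mean_square_sums_inner_tendsto[OF assms square_integrable_const[of 1]] int by simp
  then show ?thesis by (simp add: LIM_zero_iff)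
qed

text \<open>Write the partial sum as \<open>S\<close> plus the error \<open>D n\<close> and expand
  the square: the error term vanishes by assumption, the cross term by weak convergence.\<close>

lemma mean_square_sums_second_moment_tendsto:
  fixes S :: "'w \<Rightarrow> real"
  assumes "mean_square_sums M f S"
  shows "(\<lambda>n. \<integral>\<omega>. (\<Sum>i<n. f i \<omega>)\<^sup>2 \<partial>M) \<longlonglongrightarrow> (\<integral>\<omega>. (S \<omega>)\<^sup>2 \<partial>M)"
proof -
  define D where "D n \<omega> = (\<Sum>i<n. f i \<omega>) - S \<omega>" for n \<omega>
  have S: "square_integrable M S" using assms by (simp add: mean_square_sums_def)
  have D: "square_integrable M (D n)" for n
    unfolding D_def using assms
    by (intro square_integrable_diff square_integrable_sum) (auto simp: mean_square_sums_def)
  have "(\<integral>\<omega>. (\<Sum>i<n. f i \<omega>)\<^sup>2 \<partial>M)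
      = (\<integral>\<omega>. (D n \<omega>)\<^sup>2 \<partial>M) + 2 * (\<integral>\<omega>. D n \<omega> * S \<omega> \<partial>M) + (\<integral>\<omega>. (S \<omega>)\<^sup>2 \<partial>M)" for n
  proof -
    have "(\<integral>\<omega>. (\<Sum>i<n. f i \<omega>)\<^sup>2 \<partial>M)
        = (\<integral>\<omega>. (D n \<omega>)\<^sup>2 + 2 * (D n \<omega> * S \<omega>) + (S \<omega>)\<^sup>2 \<partial>M)"
      by (simp add: D_def power2_eq_square algebra_simps)
    then show ?thesis
      using D[of n] S integrable_mult_square_integrable[OF D[of n] S]
      by (simp add: square_integrable_def)
  qed
  moreover have "(\<lambda>n. (\<integral>\<omega>. (D n \<omega>)\<^sup>2 \<partial>M) + 2 * (\<integral>\<omega>. D n \<omega> * S \<omega> \<partial>M)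
      + (\<integral>\<omega>. (S \<omega>)\<^sup>2 \<partial>M)) \<longlonglongrightarrow> 0 + 2 * 0 + (\<integral>\<omega>. (S \<omega>)\<^sup>2 \<partial>M)"
    using assms mean_square_sums_inner_tendsto[OF assms S]
    by (intro tendsto_intros) (simp_all add: mean_square_sums_def D_def)
  ultimately show ?thesis by simp
qed

text \<open>Reduces a second moment to pairwise product moments, the quantities that stationarity
  and independence control.\<close>

lemma integral_square_sum:
  fixes \<xi> :: "'i \<Rightarrow> 'w \<Rightarrow> real"
  assumes "\<And>i. i \<in> I \<Longrightarrow> square_integrable M (\<xi> i)"
  shows "(\<integral>\<omega>. (\<Sum>i\<in>I. c i * \<xi> i \<omega>)\<^sup>2 \<partial>M)
    = (\<Sum>i\<in>I. \<Sum>j\<in>I. c i * c j * (\<integral>\<omega>. \<xi> i \<omega> * \<xi> j \<omega> \<partial>M))"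
proof -
  have "(\<integral>\<omega>. (\<Sum>i\<in>I. c i * \<xi> i \<omega>)\<^sup>2 \<partial>M)
      = (\<integral>\<omega>. (\<Sum>i\<in>I. \<Sum>j\<in>I. c i * c j * (\<xi> i \<omega> * \<xi> j \<omega>)) \<partial>M)"
    by (simp add: power2_eq_square sum_product mult_ac)
  also have "\<dots> = (\<Sum>i\<in>I. \<Sum>j\<in>I. c i * c j * (\<integral>\<omega>. \<xi> i \<omega> * \<xi> j \<omega> \<partial>M))"
    using integrable_mult_square_integrable[OF assms assms] by simp
  finally show ?thesis .
qed

section \<open>Vectorization and quadratic forms of covariance matrices\<close>

lemma bounded_linear_vectorize: "bounded_linear vectorize"
  unfolding linear_conv_bounded_linear[symmetric]
  by (rule linearI) (simp_all add: vectorize_def vec_eq_iff)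

lemma bounded_linear_inner_vectorize: "bounded_linear (\<lambda>A. x \<bullet> vectorize A)"
  using bounded_linear_compose[OF bounded_linear_inner_right bounded_linear_vectorize] .

text \<open>Bilinearity in the centered coordinates; square integrability allows exchanging the
  finite sums with the expectation. Matrix claims become claims about the scalar variables
  \<open>x \<bullet> U \<omega>\<close>.\<close>

lemma (in prob_space) inner_cross_cov:
  fixes U V :: "'a \<Rightarrow> real^'d"
  assumes U: "square_integrable M U" and V: "square_integrable M V"
  shows "x \<bullet> (cross_cov M U V *v y)
    = expectation (\<lambda>\<omega>. (x \<bullet> U \<omega> - expectation (\<lambda>\<omega>. x \<bullet> U \<omega>))
        * (y \<bullet> V \<omega> - expectation (\<lambda>\<omega>. y \<bullet> V \<omega>)))"
proof -
  have si: "square_integrable M (\<lambda>\<omega>. W \<omega> $ i)" if "square_integrable M W" for W :: "'a \<Rightarrow> real^'d" and i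
    using square_integrable_bounded_linear[OF bounded_linear_vec_nth that] .
  define C where "C W i \<omega> = W \<omega> $ i - expectation (\<lambda>\<omega>. W \<omega> $ i)" for W :: "'a \<Rightarrow> real^'d" and i \<omega>
  have C: "square_integrable M (C W i)" if "square_integrable M W" for W i
    unfolding C_def by (intro square_integrable_diff square_integrable_const si that)
  have eq: "z \<bullet> W \<omega> - expectation (\<lambda>\<omega>. z \<bullet> W \<omega>) = (\<Sum>i\<in>UNIV. z $ i * C W i \<omega>)"
    if "square_integrable M W" for z W \<omega>
  proof -
    have "expectation (\<lambda>\<omega>. z \<bullet> W \<omega>) = (\<Sum>i\<in>UNIV. z $ i * expectation (\<lambda>\<omega>. W \<omega> $ i))"
      using square_integrable_imp_integrable_real[OF si[OF that]] by (simp add: inner_vec_def)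
    then show ?thesis
      by (simp add: inner_vec_def C_def sum_subtractf algebra_simps)
  qed
  have "x \<bullet> (cross_cov M U V *v y)
      = (\<Sum>i\<in>UNIV. \<Sum>j\<in>UNIV. x $ i * y $ j * expectation (\<lambda>\<omega>. C U i \<omega> * C V j \<omega>))"
    by (simp add: inner_vec_def matrix_vector_mult_def cross_cov_def C_def sum_distrib_left mult_ac)
  also have "\<dots> = expectation (\<lambda>\<omega>. \<Sum>i\<in>UNIV. \<Sum>j\<in>UNIV. x $ i * y $ j * (C U i \<omega> * C V j \<omega>))"
    using integrable_mult_square_integrable[OF C[OF U] C[OF V]] by simp
  also have "\<dots> = expectation (\<lambda>\<omega>. (\<Sum>i\<in>UNIV. x $ i * C U i \<omega>) * (\<Sum>j\<in>UNIV. y $ j * C V j \<omega>))"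
    by (simp add: sum_product mult_ac)
  finally show ?thesis by (simp only: eq[OF U] eq[OF V])
qed

lemma transpose_Cov: "transpose (Cov M V) = Cov M V"
  by (simp add: Cov_def cross_cov_def transpose_def vec_eq_iff mult.commute)

lemma transpose_minus: "transpose (A - B) = transpose A - transpose (B :: 'a::ab_group_add^'n^'m)"
  by (simp add: transpose_def vec_eq_iff)

text \<open>Polarization for the difference \<open>D\<close>: expanding its form at
  \<open>x + y\<close> leaves twice the bilinear value, by symmetry. Then \<open>D *v y\<close> is
  tested against itself.\<close>

lemma symmetric_matrix_eqI:
  fixes A B :: "real^'d^'d"
  assumes "transpose A = A" "transpose B = B" and "\<And>x. x \<bullet> (A *v x) = x \<bullet> (B *v x)"
  shows "A = B"
proof -
  define D where "D = A - B"
  have sym: "transpose D = D" using assms by (simp add: D_def transpose_minus)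
  have zero: "x \<bullet> (D *v x) = 0" for x
    using assms(3) by (simp add: D_def matrix_vector_mult_diff_rdistrib inner_diff_right)
  have bilinear: "x \<bullet> (D *v y) = 0" for x y
  proof -
    have "y \<bullet> (D *v x) = x \<bullet> (D *v y)"
      by (metis dot_lmul_matrix inner_commute sym transpose_matrix_vector)
    then show ?thesis
      using zero[of "x + y"] zero[of x] zero[of y]
      by (simp add: matrix_vector_right_distrib inner_add_left inner_add_right)
  qed
  have "D *v y = 0" for y using bilinear[of "D *v y" y] by simp
  then have "D = 0" by (metis matrix_eq matrix_vector_mult_0)
  then show ?thesis by (simp add: D_def)
qed

section \<open>Covariances of steady states\<close>

text \<open>For a centered limit the quadratic form of the covariance is a plain second moment,
  which is the limit of those of the partial sums. Stated for general \<open>\<gamma>\<close> and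
  \<open>U\<close>, it serves both recursions.\<close>

lemma (in prob_space) steady_state_quadratic_form_tendsto:
  fixes U W :: "int \<Rightarrow> 'a \<Rightarrow> real^'n^'m"
  assumes "steady_state M \<gamma> U W" and centered: "\<And>t. expectation (\<lambda>\<omega>. x \<bullet> vectorize (U t \<omega>)) = 0"
  shows "(\<lambda>n. expectation (\<lambda>\<omega>. (\<Sum>i<n. (1 - \<gamma>) * \<gamma> ^ i * (x \<bullet> vectorize (U (t - int i) \<omega>)))\<^sup>2))
    \<longlonglongrightarrow> x \<bullet> (Cov M (\<lambda>\<omega>. vectorize (W t \<omega>)) *v x)"
proof -
  have ms: "mean_square_sums M (\<lambda>i \<omega>. ((1 - \<gamma>) * \<gamma> ^ i) *\<^sub>R U (t - int i) \<omega>) (W t)"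
    using assms(1) by (simp add: steady_state_def)
  interpret \<phi>: bounded_linear "\<lambda>A. x \<bullet> vectorize (A :: real^'n^'m)"
    by (rule bounded_linear_inner_vectorize)
  have ms': "mean_square_sums M (\<lambda>i \<omega>. (1 - \<gamma>) * \<gamma> ^ i * (x \<bullet> vectorize (U (t - int i) \<omega>)))
      (\<lambda>\<omega>. x \<bullet> vectorize (W t \<omega>))"
    using mean_square_sums_bounded_linear[OF bounded_linear_inner_vectorize[of x] ms]
    by (simp add: \<phi>.scaleR)
  \<comment> \<open>Every partial sum has expectation zero, hence so does the mean-square
    limit.\<close>
  have "(\<lambda>n. 0 :: real) \<longlonglongrightarrow> expectation (\<lambda>\<omega>. x \<bullet> vectorize (W t \<omega>))"
    using mean_square_sums_expectation_tendsto[OF ms'] by (simp add: centered)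
  then have "expectation (\<lambda>\<omega>. x \<bullet> vectorize (W t \<omega>)) = 0"
    using LIMSEQ_const_iff by metis
  moreover have "square_integrable M (\<lambda>\<omega>. vectorize (W t \<omega>))"
    using ms by (auto simp: mean_square_sums_def
        intro: square_integrable_bounded_linear[OF bounded_linear_vectorize])
  ultimately have "x \<bullet> (Cov M (\<lambda>\<omega>. vectorize (W t \<omega>)) *v x)
      = expectation (\<lambda>\<omega>. (x \<bullet> vectorize (W t \<omega>))\<^sup>2)"
    unfolding Cov_def by (subst inner_cross_cov) (simp_all add: power2_eq_square)
  then show ?thesis using mean_square_sums_second_moment_tendsto[OF ms'] by simp
qed

lemma sum_geometric_weights:
  fixes \<gamma> :: real
  assumes "\<gamma> \<noteq> 1"
  shows "(\<Sum>k<K. (1 - \<gamma>) * \<gamma> ^ k) = 1 - \<gamma> ^ K"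
  using one_diff_power_eq[of \<gamma> K] by (simp add: sum_distrib_left)

text \<open>With \<open>n * K\<close> terms on the left, each residue class modulo \<open>K\<close>
  contributes exactly \<open>n\<close> terms, so the convex decomposition is already exact for
  partial sums.\<close>

lemma stationary_second_moment_le:
  fixes \<xi> :: "int \<Rightarrow> 'w \<Rightarrow> real" and \<beta> :: real
  assumes si: "\<And>t. square_integrable M (\<xi> t)"
    and stat: "\<And>s t h. (\<integral>\<omega>. \<xi> (s + h) \<omega> * \<xi> (t + h) \<omega> \<partial>M) = (\<integral>\<omega>. \<xi> s \<omega> * \<xi> t \<omega> \<partial>M)"
    and \<beta>: "0 < \<beta>" "\<beta> < 1" and K: "K \<ge> 1"
  shows "(\<integral>\<omega>. (\<Sum>i<n * K. (1 - \<beta>) * \<beta> ^ i * \<xi> (t - int i) \<omega>)\<^sup>2 \<partial>M)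
    \<le> (\<integral>\<omega>. (\<Sum>i<n. (1 - \<beta> ^ K) * (\<beta> ^ K) ^ i * \<xi> (t - int i * int K) \<omega>)\<^sup>2 \<partial>M)"
proof -
  define b where "b = \<beta> ^ K"
  have b: "b < 1" using \<beta> K by (simp add: b_def power_less_one_iff)
  \<comment> \<open>The \<open>n\<close>-term partial sum of the slow recursion, with its time
    origin moved back by \<open>k\<close>.\<close>
  define P where "P k \<omega> = (\<Sum>i<n. (1 - b) * b ^ i * \<xi> (t - int k - int i * int K) \<omega>)" for k \<omega>
  \<comment> \<open>Chosen so that the fast weight at index \<open>k + i * K\<close> is
    \<open>w k * ((1 - b) * b ^ i)\<close>. Division by \<open>1 - b\<close> normalizes the total to
    1.\<close>
  define w where "w k = (1 - \<beta>) * \<beta> ^ k / (1 - b)" for k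
  have w: "(\<Sum>k<K. w k) = 1" "\<And>k. w k \<ge> 0"
    using sum_geometric_weights[of \<beta> K] \<beta> b
    by (auto simp: w_def b_def sum_divide_distrib[symmetric])
  have split: "(\<Sum>i<n * K. (1 - \<beta>) * \<beta> ^ i * \<xi> (t - int i) \<omega>) = (\<Sum>k<K. w k * P k \<omega>)" for \<omega>
  proof -
    have "(\<Sum>i<n * K. (1 - \<beta>) * \<beta> ^ i * \<xi> (t - int i) \<omega>)
        = (\<Sum>i<n. \<Sum>k<K. (1 - \<beta>) * \<beta> ^ (k + i * K) * \<xi> (t - int (k + i * K)) \<omega>)"
      by (subst sum.nat_group[symmetric])
        (simp add: sum.atLeastLessThan_shift_0[of _ "_ * K"] atLeast0LessThan add.commute)
    also have "\<dots> = (\<Sum>k<K. \<Sum>i<n. (1 - \<beta>) * \<beta> ^ (k + i * K) * \<xi> (t - int (k + i * K)) \<omega>)"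
      by (rule sum.swap)
    also have "\<dots> = (\<Sum>k<K. w k * P k \<omega>)"
      using b by (intro sum.cong refl)
        (simp add: w_def P_def sum_distrib_left b_def power_add power_mult[symmetric]
          mult_ac diff_diff_eq)
    finally show ?thesis .
  qed
  have P: "square_integrable M (P k)" for k
    unfolding P_def
    by (intro square_integrable_sum square_integrable_bounded_linear[OF bounded_linear_mult_right] si)
  \<comment> \<open>Moving all times by \<open>- int k\<close> leaves every pairwise moment
    unchanged, so all shifted copies share one second moment.\<close>
  have moment: "(\<integral>\<omega>. (P k \<omega>)\<^sup>2 \<partial>M) = (\<integral>\<omega>. (P 0 \<omega>)\<^sup>2 \<partial>M)" for k
  proof -
    have "(\<integral>\<omega>. \<xi> (t - int k - int i * int K) \<omega> * \<xi> (t - int k - int j * int K) \<omega> \<partial>M)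
        = (\<integral>\<omega>. \<xi> (t - int i * int K) \<omega> * \<xi> (t - int j * int K) \<omega> \<partial>M)" for i j
      using stat[of "t - int i * int K" "- int k" "t - int j * int K"] by (simp add: algebra_simps)
    then show ?thesis
      by (simp add: P_def integral_square_sum si)
  qed
  have intP: "integrable M (\<lambda>\<omega>. (P k \<omega>)\<^sup>2)" for k
    using P by (simp add: square_integrable_def)
  have "(\<integral>\<omega>. (\<Sum>k<K. w k * P k \<omega>)\<^sup>2 \<partial>M) \<le> (\<integral>\<omega>. (\<Sum>k<K. w k * (P k \<omega>)\<^sup>2) \<partial>M)"
  proof (rule integral_mono)
    have "square_integrable M (\<lambda>\<omega>. \<Sum>k<K. w k * P k \<omega>)"
      by (intro square_integrable_sum square_integrable_bounded_linear[OF bounded_linear_mult_right] P)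
    then show "integrable M (\<lambda>\<omega>. (\<Sum>k<K. w k * P k \<omega>)\<^sup>2)" by (simp add: square_integrable_def)
    show "integrable M (\<lambda>\<omega>. \<Sum>k<K. w k * (P k \<omega>)\<^sup>2)" using intP by simp
    \<comment> \<open>Jensen's inequality, pointwise in \<open>\<omega>\<close>;
      \<open>K \<ge> 1\<close> makes the index set nonempty.\<close>
    show "(\<Sum>k<K. w k * P k \<omega>)\<^sup>2 \<le> (\<Sum>k<K. w k * (P k \<omega>)\<^sup>2)" for \<omega>
      using convex_on_sum[OF _ _ convex_power2 w(1), of "\<lambda>k. P k \<omega>"] w(2) K
      by (simp add: lessThan_empty_iff)
  qed
  also have "\<dots> = (\<Sum>k<K. w k * (\<integral>\<omega>. (P k \<omega>)\<^sup>2 \<partial>M))"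
    using intP by simp
  also have "\<dots> = (\<Sum>k<K. w k * (\<integral>\<omega>. (P 0 \<omega>)\<^sup>2 \<partial>M))"
    by (intro sum.cong refl arg_cong[where f = "(*) _"] moment)
  also have "\<dots> = (\<integral>\<omega>. (P 0 \<omega>)\<^sup>2 \<partial>M)"
    by (simp add: sum_distrib_right[symmetric] w(1))
  finally show ?thesis by (simp add: split P_def b_def)
qed

text \<open>Only vanishing cross moments in each fixed direction \<open>x\<close> are required,
  since quadratic forms determine a symmetric matrix. The general input \<open>U\<close> covers both
  \<open>X\<close> and its subsampled version.\<close>

lemma (in prob_space) steady_state_Cov_orthogonal:
  fixes U W :: "int \<Rightarrow> 'a \<Rightarrow> real^'n^'m"
  assumes ss: "steady_state M \<gamma> U W" and \<gamma>: "0 < \<gamma>" "\<gamma> < 1"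
    and si: "\<And>t. square_integrable M (U t)"
    and mean: "\<And>x t. expectation (\<lambda>\<omega>. x \<bullet> vectorize (U t \<omega>)) = 0"
    and orth: "\<And>x s t. s \<noteq> t \<Longrightarrow>
      expectation (\<lambda>\<omega>. (x \<bullet> vectorize (U s \<omega>)) * (x \<bullet> vectorize (U t \<omega>))) = 0"
    and Cov: "\<And>t. Cov M (\<lambda>\<omega>. vectorize (U t \<omega>)) = \<Sigma>"
  shows "Cov M (\<lambda>\<omega>. vectorize (W t \<omega>)) = ((1 - \<gamma>) / (1 + \<gamma>)) *\<^sub>R \<Sigma>"
proof (rule symmetric_matrix_eqI)
  show "transpose (((1 - \<gamma>) / (1 + \<gamma>)) *\<^sub>R \<Sigma>) = ((1 - \<gamma>) / (1 + \<gamma>)) *\<^sub>R \<Sigma>"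
    \<comment> \<open>\<open>\<Sigma>\<close> is symmetric because it is the covariance of the input
      at time 0.\<close>
    using transpose_Cov[of M "\<lambda>\<omega>. vectorize (U 0 \<omega>)"]
    by (simp add: Cov transpose_def vec_eq_iff)
next
  fix x :: "real^('n \<times> 'm)"
  let ?\<xi> = "\<lambda>t \<omega>. x \<bullet> vectorize (U t \<omega>)"
  have second: "expectation (\<lambda>\<omega>. ?\<xi> s \<omega> * ?\<xi> s \<omega>) = x \<bullet> (\<Sigma> *v x)" for s
    using inner_cross_cov[OF square_integrable_bounded_linear[OF bounded_linear_vectorize si]
        square_integrable_bounded_linear[OF bounded_linear_vectorize si], of x s s x]
    by (simp add: mean Cov[unfolded Cov_def])
  have off: "expectation (\<lambda>\<omega>. ?\<xi> (t - int i) \<omega> * ?\<xi> (t - int j) \<omega>)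
      = (if j = i then x \<bullet> (\<Sigma> *v x) else 0)" for i j
    using orth second by auto
  have "expectation (\<lambda>\<omega>. (\<Sum>i<n. (1 - \<gamma>) * \<gamma> ^ i * ?\<xi> (t - int i) \<omega>)\<^sup>2)
      = (\<Sum>i<n. (\<gamma>\<^sup>2) ^ i) * ((1 - \<gamma>)\<^sup>2 * (x \<bullet> (\<Sigma> *v x)))" for n
  proof -
    have "expectation (\<lambda>\<omega>. (\<Sum>i<n. (1 - \<gamma>) * \<gamma> ^ i * ?\<xi> (t - int i) \<omega>)\<^sup>2)
        = (\<Sum>i<n. \<Sum>j<n. (1 - \<gamma>) * \<gamma> ^ i * ((1 - \<gamma>) * \<gamma> ^ j)
            * (if j = i then x \<bullet> (\<Sigma> *v x) else 0))"
      by (subst integral_square_sum)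
        (simp_all only: off square_integrable_bounded_linear[OF bounded_linear_inner_vectorize si])
    also have "\<dots> = (\<Sum>i<n. (\<gamma>\<^sup>2) ^ i * ((1 - \<gamma>)\<^sup>2 * (x \<bullet> (\<Sigma> *v x))))"
      by (simp add: if_distrib[of "\<lambda>y. _ * y"] power2_eq_square power_mult_distrib mult_ac cong: if_cong)
    finally show ?thesis by (simp add: sum_distrib_right)
  qed
  \<comment> \<open>The diagonal terms carry squared weights, hence a geometric series of ratio
    \<open>\<gamma>\<^sup>2\<close>.\<close>
  moreover have "(\<lambda>n. (\<Sum>i<n. (\<gamma>\<^sup>2) ^ i) * ((1 - \<gamma>)\<^sup>2 * (x \<bullet> (\<Sigma> *v x))))
      \<longlonglongrightarrow> 1 / (1 - \<gamma>\<^sup>2) * ((1 - \<gamma>)\<^sup>2 * (x \<bullet> (\<Sigma> *v x)))"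
    using geometric_sums[of "\<gamma>\<^sup>2"] \<gamma>
    by (intro tendsto_mult_right) (simp add: sums_def power_less_one_iff)
  ultimately have "(\<lambda>n. expectation (\<lambda>\<omega>. (\<Sum>i<n. (1 - \<gamma>) * \<gamma> ^ i * ?\<xi> (t - int i) \<omega>)\<^sup>2))
      \<longlonglongrightarrow> 1 / (1 - \<gamma>\<^sup>2) * ((1 - \<gamma>)\<^sup>2 * (x \<bullet> (\<Sigma> *v x)))"
    by simp
  with steady_state_quadratic_form_tendsto[OF ss mean]
  have "x \<bullet> (Cov M (\<lambda>\<omega>. vectorize (W t \<omega>)) *v x)
      = 1 / (1 - \<gamma>\<^sup>2) * ((1 - \<gamma>)\<^sup>2 * (x \<bullet> (\<Sigma> *v x)))"
    using LIMSEQ_unique by blast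
  \<comment> \<open>This factorization cancels one factor \<open>1 - \<gamma>\<close> and leaves the
    stated ratio.\<close>
  also have "1 - \<gamma>\<^sup>2 = (1 - \<gamma>) * (1 + \<gamma>)" by (simp add: power2_eq_square algebra_simps)
  finally show "x \<bullet> (Cov M (\<lambda>\<omega>. vectorize (W t \<omega>)) *v x)
      = x \<bullet> ((((1 - \<gamma>) / (1 + \<gamma>)) *\<^sub>R \<Sigma>) *v x)"
    using \<gamma> by (simp add: power2_eq_square scaleR_matrix_vector_assoc[symmetric])
qed (rule transpose_Cov)

section \<open>Lag of the held estimator on an affine signal\<close>

text \<open>The geometric weights sum to 1 and have mean index \<open>b / (1 - b)\<close>, each
  index step being a delay of \<open>K\<close>. An affine signal averaged over delays equals the
  signal at the mean delay.\<close>

lemma det_steady_state_affine: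
  fixes a v :: "'b::euclidean_space" and b :: real
  assumes "det_steady_state b (\<lambda>j. affine_signal a v (of_int (j * int K))) Y" and "0 < b" "b < 1"
  shows "Y j = affine_signal a v (of_int j * real K - real K * b / (1 - b))"
proof -
  have "norm b < 1" using assms by simp
  have s0: "(\<lambda>i. (1 - b) * b ^ i) sums 1"
    using sums_mult[OF geometric_sums[OF \<open>norm b < 1\<close>], of "1 - b"] assms by simp
  \<comment> \<open>The series of \<open>b ^ i * real i\<close> has sum
    \<open>b / (1 - b)\<^sup>2\<close>; the normalization \<open>1 - b\<close> removes one
    factor.\<close>
  have s1: "(\<lambda>i. (1 - b) * real K * (b ^ i * real i)) sums (real K * b / (1 - b))"
  proof -
    have "(1 - b) * real K * (b / (1 - b)\<^sup>2) = real K * b / (1 - b)"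
      using assms by (simp add: power2_eq_square)
    then show ?thesis
      using sums_mult[OF geometric_sums_times_n[OF \<open>norm b < 1\<close>], of "(1 - b) * real K"] by simp
  qed
  have "(\<lambda>i. ((1 - b) * b ^ i) *\<^sub>R (a + (of_int j * real K) *\<^sub>R v)
        - ((1 - b) * real K * (b ^ i * real i)) *\<^sub>R v)
      sums (1 *\<^sub>R (a + (of_int j * real K) *\<^sub>R v) - (real K * b / (1 - b)) *\<^sub>R v)"
    by (intro sums_diff sums_scaleR_left s0 s1)
  moreover have "(\<lambda>i. ((1 - b) * b ^ i) *\<^sub>R affine_signal a v (of_int ((j - int i) * int K))) sums Y j"
    using assms(1) unfolding det_steady_state_def by blast
  moreover have "((1 - b) * b ^ i) *\<^sub>R affine_signal a v (of_int ((j - int i) * int K))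
      = ((1 - b) * b ^ i) *\<^sub>R (a + (of_int j * real K) *\<^sub>R v)
        - ((1 - b) * real K * (b ^ i * real i)) *\<^sub>R v" for i
    by (simp add: affine_signal_def algebra_simps)
  ultimately have "Y j = 1 *\<^sub>R (a + (of_int j * real K) *\<^sub>R v) - (real K * b / (1 - b)) *\<^sub>R v"
    using sums_unique2 by fastforce
  then show ?thesis by (simp add: affine_signal_def algebra_simps)
qed

lemma phase_averaged_lag_affine:
  fixes a v :: "'b::euclidean_space" and b :: real
  assumes "det_steady_state b (\<lambda>j. affine_signal a v (of_int (j * int K))) Y" and "0 < b" "b < 1"
    and "v \<noteq> 0" and "K \<ge> 1"
  shows "\<forall>s<K. \<exists>!l. is_lag K a v Y j s l"
    and "phase_averaged_lag K a v Y j = real K * b / (1 - b) + (real K - 1) / 2"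
proof -
  have iff: "is_lag K a v Y j s l \<longleftrightarrow> l = real s + real K * b / (1 - b)" if "s < K" for s l
  proof -
    \<comment> \<open>The phase \<open>s < K\<close> does not change the quotient, so the held value
      throughout the block is \<open>Y j\<close>.\<close>
    have "(j * int K + int s) div int K = j" using that by simp
    then have "is_lag K a v Y j s l \<longleftrightarrow> (real s + real K * b / (1 - b)) *\<^sub>R v = l *\<^sub>R v"
      by (simp add: is_lag_def held_def det_steady_state_affine[OF assms(1-3)] affine_signal_def
          algebra_simps)
    \<comment> \<open>As \<open>v\<close> is nonzero, its coefficient is determined, so the
      description in \<open>lag\<close> denotes this unique value.\<close>
    then show ?thesis using \<open>v \<noteq> 0\<close> by auto
  qed
  then show "\<forall>s<K. \<exists>!l. is_lag K a v Y j s l" by simp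
  have "(\<Sum>s<K. lag K a v Y j s) = (\<Sum>s<K. real s + real K * b / (1 - b))"
    by (simp add: lag_def iff)
  also have "\<dots> = real K * (real K - 1) / 2 + real K * (real K * b / (1 - b))"
  proof -
    have "(\<Sum>s<n. real s) = real n * (real n - 1) / 2" for n
      by (induction n) (simp_all add: field_simps)
    then show ?thesis by (simp add: sum.distrib)
  qed
  finally show "phase_averaged_lag K a v Y j = real K * b / (1 - b) + (real K - 1) / 2"
    using \<open>K \<ge> 1\<close> by (simp add: phase_averaged_lag_def field_simps)
qed

section \<open>The comparison of the fast and the held recursion\<close>

theorem proposition6:
  fixes M :: "'w measure"
    and X :: "int \<Rightarrow> 'w \<Rightarrow> real^'n^'m"
    and \<beta> :: real and K :: nat
  assumes "prob_space M"
    and "0 < \<beta>" and "\<beta> < 1" and "K \<ge> 1"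
    and "centered_process M X"
  shows
    "(\<forall>Z Y.
        weakly_stationary M (\<lambda>t \<omega>. vectorize (X t \<omega>)) \<and>
        steady_state M \<beta> X Z \<and>
        steady_state M (\<beta> ^ K) (\<lambda>j. X (j * int K)) Y \<longrightarrow>
        (\<forall>j. Cov M (\<lambda>\<omega>. vectorize (Y j \<omega>)) \<succeq> Cov M (\<lambda>\<omega>. vectorize (Z (j * int K) \<omega>)))) \<and>
     (\<forall>Z Y \<Sigma>.
        iid_process M X \<and>
        (\<forall>t. square_integrable M (\<lambda>\<omega>. vectorize (X t \<omega>)) \<and>
             Cov M (\<lambda>\<omega>. vectorize (X t \<omega>)) = \<Sigma>) \<and>
        steady_state M \<beta> X Z \<and>
        steady_state M (\<beta> ^ K) (\<lambda>j. X (j * int K)) Y \<longrightarrow>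
        (\<forall>j. Cov M (\<lambda>\<omega>. vectorize (Y j \<omega>)) = ((1 - \<beta> ^ K) / (1 + \<beta> ^ K)) *\<^sub>R \<Sigma>) \<and>
        (\<forall>t. Cov M (\<lambda>\<omega>. vectorize (Z t \<omega>)) = ((1 - \<beta>) / (1 + \<beta>)) *\<^sub>R \<Sigma>)) \<and>
     (\<forall>(a :: real^'n^'m) v Y.
        v \<noteq> 0 \<and>
        det_steady_state (\<beta> ^ K) (\<lambda>j. affine_signal a v (of_int (j * int K))) Y \<longrightarrow>
        (\<forall>j. (\<forall>s<K. \<exists>!l. is_lag K a v Y j s l) \<and>
             phase_averaged_lag K a v Y j
               = real K * \<beta> ^ K / (1 - \<beta> ^ K) + (real K - 1) / 2))"
proof -
  interpret prob_space M by fact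
  have K: "int K > 0" and b: "0 < \<beta> ^ K" "\<beta> ^ K < 1"
    using \<open>0 < \<beta>\<close> \<open>\<beta> < 1\<close> \<open>K \<ge> 1\<close> by (auto simp: power_less_one_iff)
  have mean: "expectation (\<lambda>\<omega>. x \<bullet> vectorize (X t \<omega>)) = 0" for x t
    using \<open>centered_process M X\<close> integral_bounded_linear[OF bounded_linear_inner_vectorize, of M "X t" x]
    by (simp add: centered_process_def vectorize_def inner_vec_def)
  have si: "square_integrable M (X t)" if "steady_state M \<beta> X Z" for Z t
  proof -
    \<comment> \<open>The term of index 0 in the series for \<open>Z t\<close> is
      \<open>(1 - \<beta>) *\<^sub>R X t\<close>; dividing by the nonzero factor recovers
      \<open>X t\<close>.\<close>
    have "square_integrable M (\<lambda>\<omega>. (1 - \<beta>) *\<^sub>R X t \<omega>)"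
      using that unfolding steady_state_def mean_square_sums_def
      by (auto dest!: spec[of _ t] spec[of _ "0::nat"])
    from square_integrable_bounded_linear[OF bounded_linear_scaleR_right this, of "1 / (1 - \<beta>)"]
    show ?thesis using \<open>\<beta> < 1\<close> by simp
  qed
  have part1: "Cov M (\<lambda>\<omega>. vectorize (Y j \<omega>)) \<succeq> Cov M (\<lambda>\<omega>. vectorize (Z (j * int K) \<omega>))"
    if stat: "weakly_stationary M (\<lambda>t \<omega>. vectorize (X t \<omega>))"
      and Z: "steady_state M \<beta> X Z" and Y: "steady_state M (\<beta> ^ K) (\<lambda>j. X (j * int K)) Y" for Z Y j
  proof -
    have vsi: "square_integrable M (\<lambda>\<omega>. vectorize (X t \<omega>))" for t
      using stat by (simp add: weakly_stationary_def)
    have "x \<bullet> (Cov M (\<lambda>\<omega>. vectorize (Z (j * int K) \<omega>)) *v x)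
        \<le> x \<bullet> (Cov M (\<lambda>\<omega>. vectorize (Y j \<omega>)) *v x)" for x
    proof (rule LIMSEQ_le)
      let ?\<xi> = "\<lambda>t \<omega>. x \<bullet> vectorize (X t \<omega>)"
      \<comment> \<open>The comparison concerns fast partial sums of length \<open>n * K\<close>, so
        the limit for \<open>Z\<close> is taken along this subsequence.\<close>
      have "filterlim (\<lambda>n. n * K) sequentially sequentially"
        using \<open>K \<ge> 1\<close> by (intro filterlim_subseq strict_monoI) simp
      then show "(\<lambda>n. expectation (\<lambda>\<omega>. (\<Sum>i<n * K. (1 - \<beta>) * \<beta> ^ i * ?\<xi> (j * int K - int i) \<omega>)\<^sup>2))
          \<longlonglongrightarrow> x \<bullet> (Cov M (\<lambda>\<omega>. vectorize (Z (j * int K) \<omega>)) *v x)"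
        by (rule filterlim_compose[OF steady_state_quadratic_form_tendsto[OF Z mean]])
      show "(\<lambda>n. expectation (\<lambda>\<omega>. (\<Sum>i<n. (1 - \<beta> ^ K) * (\<beta> ^ K) ^ i * ?\<xi> ((j - int i) * int K) \<omega>)\<^sup>2))
          \<longlonglongrightarrow> x \<bullet> (Cov M (\<lambda>\<omega>. vectorize (Y j \<omega>)) *v x)"
        by (rule steady_state_quadratic_form_tendsto[OF Y mean])
      have "expectation (\<lambda>\<omega>. ?\<xi> (s + h) \<omega> * ?\<xi> (t + h) \<omega>) = expectation (\<lambda>\<omega>. ?\<xi> s \<omega> * ?\<xi> t \<omega>)"
        for s t h
      proof -
        \<comment> \<open>The means vanish, so the raw product moments are forms of
          \<open>cross_cov\<close>, which weak stationarity makes shift invariant.\<close>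
        have "expectation (\<lambda>\<omega>. ?\<xi> s \<omega> * ?\<xi> t \<omega>) = x \<bullet> (cross_cov M (\<lambda>\<omega>. vectorize (X s \<omega>))
            (\<lambda>\<omega>. vectorize (X t \<omega>)) *v x)" for s t
          by (simp add: inner_cross_cov[OF vsi vsi] mean)
        then show ?thesis using stat by (simp add: weakly_stationary_def)
      qed
      then show "\<exists>N. \<forall>n\<ge>N.
          expectation (\<lambda>\<omega>. (\<Sum>i<n * K. (1 - \<beta>) * \<beta> ^ i * ?\<xi> (j * int K - int i) \<omega>)\<^sup>2)
          \<le> expectation (\<lambda>\<omega>. (\<Sum>i<n. (1 - \<beta> ^ K) * (\<beta> ^ K) ^ i * ?\<xi> ((j - int i) * int K) \<omega>)\<^sup>2)"
        using stationary_second_moment_le[of M ?\<xi> \<beta> K, where t = "j * int K"] \<open>0 < \<beta>\<close> \<open>\<beta> < 1\<close> \<open>K \<ge> 1\<close>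
          square_integrable_bounded_linear[OF bounded_linear_inner_vectorize si[OF Z]]
        by (simp add: left_diff_distrib)
    qed
    then show ?thesis
      by (simp add: loewner_ge_def psd_def transpose_minus transpose_Cov
          matrix_vector_mult_diff_rdistrib inner_diff_right)
  qed
  have part2: "Cov M (\<lambda>\<omega>. vectorize (Y j \<omega>)) = ((1 - \<beta> ^ K) / (1 + \<beta> ^ K)) *\<^sub>R \<Sigma>"
    "Cov M (\<lambda>\<omega>. vectorize (Z t \<omega>)) = ((1 - \<beta>) / (1 + \<beta>)) *\<^sub>R \<Sigma>"
    if iid: "iid_process M X" and Cov: "\<And>t. Cov M (\<lambda>\<omega>. vectorize (X t \<omega>)) = \<Sigma>"
      and Z: "steady_state M \<beta> X Z" and Y: "steady_state M (\<beta> ^ K) (\<lambda>j. X (j * int K)) Y"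
    for Z Y \<Sigma> j t
  proof -
    have orth: "expectation (\<lambda>\<omega>. (x \<bullet> vectorize (X s \<omega>)) * (x \<bullet> vectorize (X t \<omega>))) = 0"
      if "s \<noteq> t" for x s t
    proof -
      let ?\<phi> = "\<lambda>A :: real^'n^'m. x \<bullet> vectorize A"
      have "?\<phi> \<in> borel_measurable borel"
        by (simp add: borel_measurable_continuous_onI linear_continuous_on bounded_linear_inner_vectorize)
      moreover have "indep_vars (\<lambda>_. borel) X UNIV"
        using iid unfolding iid_process_def by blast
      ultimately have "indep_vars (\<lambda>_. borel) (\<lambda>t \<omega>. ?\<phi> (X t \<omega>)) UNIV"
        using indep_vars_compose2[of "\<lambda>_. borel" X UNIV "\<lambda>_. ?\<phi>" "\<lambda>_. borel"] by blast
      then have ind: "indep_vars (\<lambda>_. borel) (\<lambda>t \<omega>. ?\<phi> (X t \<omega>)) {s, t}"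
        by (rule indep_vars_subset) simp
      have "integrable M (\<lambda>\<omega>. ?\<phi> (X t \<omega>))" for t
        using si[OF Z] by (intro square_integrable_imp_integrable_real
            square_integrable_bounded_linear[OF bounded_linear_inner_vectorize])
      \<comment> \<open>Independence factors the expectation into a product of two zero
        means.\<close>
      then show ?thesis
        using indep_vars_lebesgue_integral[OF _ ind] that by (simp add: mean)
    qed
    show "Cov M (\<lambda>\<omega>. vectorize (Z t \<omega>)) = ((1 - \<beta>) / (1 + \<beta>)) *\<^sub>R \<Sigma>"
      by (rule steady_state_Cov_orthogonal[OF Z \<open>0 < \<beta>\<close> \<open>\<beta> < 1\<close> si[OF Z] mean orth Cov])
    show "Cov M (\<lambda>\<omega>. vectorize (Y j \<omega>)) = ((1 - \<beta> ^ K) / (1 + \<beta> ^ K)) *\<^sub>R \<Sigma>"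
      \<comment> \<open>Since \<open>K\<close> is positive, distinct indices of the subsampled input
        are distinct times of \<open>X\<close>, so \<open>orth\<close> applies to it as
        well.\<close>
      using K by (intro steady_state_Cov_orthogonal[OF Y b si[OF Z] mean orth Cov]) auto
  qed
  show ?thesis
  proof (intro conjI allI impI; (elim conjE)?)
    fix Z Y j
    assume "weakly_stationary M (\<lambda>t \<omega>. vectorize (X t \<omega>))" "steady_state M \<beta> X Z"
      "steady_state M (\<beta> ^ K) (\<lambda>j. X (j * int K)) Y"
    then show "Cov M (\<lambda>\<omega>. vectorize (Y j \<omega>)) \<succeq> Cov M (\<lambda>\<omega>. vectorize (Z (j * int K) \<omega>))"
      by (rule part1)
  next
    fix Z Y \<Sigma> j
    assume hyps: "iid_process M X" "steady_state M \<beta> X Z"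
        "steady_state M (\<beta> ^ K) (\<lambda>j. X (j * int K)) Y"
      and "\<forall>t. square_integrable M (\<lambda>\<omega>. vectorize (X t \<omega>)) \<and>
        Cov M (\<lambda>\<omega>. vectorize (X t \<omega>)) = \<Sigma>"
    then have "Cov M (\<lambda>\<omega>. vectorize (X t \<omega>)) = \<Sigma>" for t by blast
    from part2(1)[OF hyps(1) this hyps(2,3)]
    show "Cov M (\<lambda>\<omega>. vectorize (Y j \<omega>)) = ((1 - \<beta> ^ K) / (1 + \<beta> ^ K)) *\<^sub>R \<Sigma>" .
  next
    fix Z Y \<Sigma> t
    assume hyps: "iid_process M X" "steady_state M \<beta> X Z"
        "steady_state M (\<beta> ^ K) (\<lambda>j. X (j * int K)) Y"
      and "\<forall>t. square_integrable M (\<lambda>\<omega>. vectorize (X t \<omega>)) \<and>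
        Cov M (\<lambda>\<omega>. vectorize (X t \<omega>)) = \<Sigma>"
    then have "Cov M (\<lambda>\<omega>. vectorize (X t \<omega>)) = \<Sigma>" for t by blast
    from part2(2)[OF hyps(1) this hyps(2,3)]
    show "Cov M (\<lambda>\<omega>. vectorize (Z t \<omega>)) = ((1 - \<beta>) / (1 + \<beta>)) *\<^sub>R \<Sigma>" .
  next
    fix a v :: "real^'n^'m" and Y j
    assume "v \<noteq> 0"
      and "det_steady_state (\<beta> ^ K) (\<lambda>j. affine_signal a v (of_int (j * int K))) Y"
    note lag = phase_averaged_lag_affine[OF this(2) b this(1) \<open>K \<ge> 1\<close>]
    show "\<exists>!l. is_lag K a v Y j s l" if "s < K" for s
      using lag(1) that by blast
    show "phase_averaged_lag K a v Y j = real K * \<beta> ^ K / (1 - \<beta> ^ K) + (real K - 1) / 2"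
      by (rule lag(2))
  qed
qed

end
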